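(* Let $\mathcal{B}$ be a bornology with a closed base on a metric space $(X,d)$ with at least two points. Then (i) $t(C(X),\tau_{\mathcal{B}}^{sw}) = dn_{\mathcal{B}}^s(X)\cdot L^s(X,\mathcal{B})$; (ii) $t(C(X),\tau_{\mathcal{B}}^{w}) = dn_{\mathcal{B}}(X)\cdot L(X,\mathcal{B})$.
   Context: A bornology on $X$ is a family $\mathcal{B}$ of nonempty subsets of $X$ that covers $X$ and is an ideal, i.e. is closed under finite unions and under passing to nonempty subsets. A base for $\mathcal{B}$ is a subfamily $\mathcal{B}_0\subseteq\mathcal{B}$ such that every $B\in\mathcal{B}$ is contained in some $B'\in\mathcal{B}_0$; $\mathcal{B}$ has a closed base if it has a base all of whose members are closed in $(X,d)$. $C(X)$ is the set of continuous functions $X\to\mathbb{R}$, and $C^+(X)$ the set of continuous functions $X\to(0,\infty)$. For $A\subseteq X$ nonempty and $\delta>0$, $A^\delta=\bigcup_{x\in A}\{y\in X: d(x,y)<\delta\}$. The topology $\tau_{\mathcal{B}}^{sw}$ (strong Whitney convergence on $\mathcal{B}$) on $C(X)$ is induced by the uniformity having as a base the sets $[B,\epsilon]^{sw}=\{(f,g): \exists\,\delta>0\ \forall x\in B^\delta,\ |f(x)-g(x)|<\epsilon(x)\}$, and $\tau_{\mathcal{B}}^{w}$ (Whitney convergence on $\mathcal{B}$) by the uniformity having as a base the sets $[B,\epsilon]^{w}=\{(f,g): |f(x)-g(x)|<\epsilon(x)\ \forall x\in B\}$, where $B\in\mathcal{B}$, $\epsilon\in C^+(X)$. A set $F\subseteq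 C(X)$ is dominating (resp. strongly dominating) with respect to $\mathcal{B}$ if for every $f\in C(X)$ and $B\in\mathcal{B}$ there is $g\in F$ with $f\le g$ on $B$ (resp. there are $g\in F$ and $\delta>0$ with $f\le g$ on $B^\delta$). Then $dn_{\mathcal{B}}(X)$ (resp. $dn_{\mathcal{B}}^s(X)$) is $\aleph_0$ plus the minimum cardinality of a dominating (resp. strongly dominating) subset of $C(X)$ with respect to $\mathcal{B}$. A collection $\mathcal{G}$ of open subsets of $X$ is an open $\mathcal{B}$-cover if every $B\in\mathcal{B}$ is contained in some $G\in\mathcal{G}$; it is a strong open $\mathcal{B}$-cover if for every $B\in\mathcal{B}$ there are $G\in\mathcal{G}$ and $\delta>0$ with $B^\delta\subseteq G$. $L(X,\mathcal{B})=\aleph_0+\min\{\mathfrak{m}:$ every open $\mathcal{B}$-cover of $X$ has a subfamily of cardinality $\le\mathfrak{m}$ that is an open $\mathcal{B}$-cover$\}$, and $L^s(X,\mathcal{B})=\aleph_0+\min\{\mathfrak{m}:$ every strong open $\mathcal{B}$-cover of $X$ has a subfamily of cardinality $\le\mathfrak{m}$ that is a strong open $\mathcal{B}$-cover$\}$. For a topological space $Y$ and $y\in Y$, $t(y,Y)=\aleph_0+\min\{\mathfrak{m}:$ for every $C\subseteq Y$ with $y\in\overline{C}$ there is $C_0\subseteq C$ with $|C_0|\le\mathfrak{m}$ and $y\in\overline{C_0}\}$; the tightness of $Y$ is $t(Y)=\sup\{t(y,Y):y\in Y\}$. *)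

theory Defs
  imports "HOL-Analysis.Analysis"
begin

unbundle cardinal_syntax

text \<open>
  Cardinals are represented, as in the BNF cardinal library, by cardinal orders (\<^const>\<open>Card_order\<close>),
  compared by \<open>\<le>o\<close> and identified by \<open>=o\<close>.  The order \<^term>\<open>least_card P\<close> represents the least
  cardinal satisfying \<open>P\<close>, where the candidates are the cardinals of the form \<open>|A|\<close> with
  \<open>A :: 'c set\<close>.  In each use below the type \<open>'c\<close> is large enough for the least cardinal of any size
  satisfying \<open>P\<close> to be among these candidates.
\<close>

definition least_card :: "('c rel \<Rightarrow> bool) \<Rightarrow> 'c rel" where
  "least_card P =
     (SOME m. Card_order m \<and> P m \<and> (\<forall>m'. Card_order m' \<and> P m' \<longrightarrow> m \<le>o m'))"

lemma least_card:
  fixes P :: "'c rel \<Rightarrow> bool"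
  assumes "Card_order m" "P m"
  shows "Card_order (least_card P)" "P (least_card P)"
    and "\<And>m'. Card_order m' \<Longrightarrow> P m' \<Longrightarrow> least_card P \<le>o m'"
proof -
  have "\<exists>r\<in>{m. Card_order m \<and> P m}. \<forall>r'\<in>{m. Card_order m \<and> P m}. r \<le>o r'"
    using assms by (intro exists_minim_Card_order) auto
  then have "\<exists>r. Card_order r \<and> P r \<and> (\<forall>m'. Card_order m' \<and> P m' \<longrightarrow> r \<le>o m')"
    by blast
  from someI_ex[OF this]
  show "Card_order (least_card P)" "P (least_card P)"
    and "\<And>m'. Card_order m' \<Longrightarrow> P m' \<Longrightarrow> least_card P \<le>o m'"
    unfolding least_card_def by blast+
qed

definition bornology :: "'a set set \<Rightarrow> bool" where
  "bornology \<B> \<longleftrightarrow>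
     {} \<notin> \<B> \<and> \<Union>\<B> = UNIV \<and>
     (\<forall>A\<in>\<B>. \<forall>B\<in>\<B>. A \<union> B \<in> \<B>) \<and>
     (\<forall>B\<in>\<B>. \<forall>A. A \<subseteq> B \<and> A \<noteq> {} \<longrightarrow> A \<in> \<B>)"

definition bornology_base :: "'a set set \<Rightarrow> 'a set set \<Rightarrow> bool" where
  "bornology_base \<B> \<B>0 \<longleftrightarrow> \<B>0 \<subseteq> \<B> \<and> (\<forall>B\<in>\<B>. \<exists>B'\<in>\<B>0. B \<subseteq> B')"

definition has_closed_base :: "'a::topological_space set set \<Rightarrow> bool" where
  "has_closed_base \<B> \<longleftrightarrow> (\<exists>\<B>0. bornology_base \<B> \<B>0 \<and> (\<forall>B\<in>\<B>0. closed B))"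

definition enlarge :: "'a::metric_space set \<Rightarrow> real \<Rightarrow> 'a set" where
  "enlarge A \<delta> = (\<Union>x\<in>A. {y. dist x y < \<delta>})"

definition C_fun :: "('a::topological_space \<Rightarrow> real) set" where
  "C_fun = {f. continuous_on UNIV f}"

definition C_pos :: "('a::topological_space \<Rightarrow> real) set" where
  "C_pos = {e. continuous_on UNIV e \<and> (\<forall>x. 0 < e x)}"

text \<open>
  The topology on \<open>S\<close> induced by a uniformity \<open>\<U>\<close> on \<open>S\<close>, the latter given by its filter of
  entourages (cf. the axiom of class \<^class>\<open>open_uniformity\<close>); \<open>S \<times> S\<close> has to be an entourage.
\<close>

definition uniformity_topology :: "'f set \<Rightarrow> ('f \<times> 'f) filter \<Rightarrow> 'f topology" where
  "uniformity_topology S \<U> =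
     topology (\<lambda>U. U \<subseteq> S \<and> (\<forall>f\<in>U. eventually (\<lambda>(f', g). f' = f \<longrightarrow> g \<in> U) \<U>))"

lemma openin_uniformity_topology:
  "openin (uniformity_topology S \<U>) U \<longleftrightarrow>
     U \<subseteq> S \<and> (\<forall>f\<in>U. eventually (\<lambda>(f', g). f' = f \<longrightarrow> g \<in> U) \<U>)"
proof -
  have "istopology (\<lambda>U. U \<subseteq> S \<and> (\<forall>f\<in>U. eventually (\<lambda>(f', g). f' = f \<longrightarrow> g \<in> U) \<U>))"
    unfolding istopology_def
  proof (intro conjI allI impI ballI; (elim conjE)?)
    fix U V f
    assume "\<forall>f\<in>U. eventually (\<lambda>(f', g). f' = f \<longrightarrow> g \<in> U) \<U>"
      and "\<forall>f\<in>V. eventually (\<lambda>(f', g). f' = f \<longrightarrow> g \<in> V) \<U>" and "f \<in> U \<inter> V"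
    then have "eventually (\<lambda>(f', g). f' = f \<longrightarrow> g \<in> U) \<U>"
      and "eventually (\<lambda>(f', g). f' = f \<longrightarrow> g \<in> V) \<U>" by auto
    then show "eventually (\<lambda>(f', g). f' = f \<longrightarrow> g \<in> U \<inter> V) \<U>"
      by eventually_elim auto
  next
    fix \<K> f
    assume *: "\<forall>K\<in>\<K>. K \<subseteq> S \<and> (\<forall>f\<in>K. eventually (\<lambda>(f', g). f' = f \<longrightarrow> g \<in> K) \<U>)"
      and "f \<in> \<Union>\<K>"
    then obtain K where K: "K \<in> \<K>" "f \<in> K" by auto
    with * have "eventually (\<lambda>(f', g). f' = f \<longrightarrow> g \<in> K) \<U>" by auto
    then show "eventually (\<lambda>(f', g). f' = f \<longrightarrow> g \<in> \<Union>\<K>) \<U>"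
      by eventually_elim (use K in auto)
  qed blast+
  then show ?thesis
    unfolding uniformity_topology_def by (simp add: topology_inverse')
qed

definition whitney_entourage ::
  "'a::metric_space set \<Rightarrow> ('a \<Rightarrow> real) \<Rightarrow> (('a \<Rightarrow> real) \<times> ('a \<Rightarrow> real)) set" where
  "whitney_entourage B e =
     {(f, g). f \<in> C_fun \<and> g \<in> C_fun \<and> (\<forall>x\<in>B. \<bar>f x - g x\<bar> < e x)}"

definition strong_whitney_entourage ::
  "'a::metric_space set \<Rightarrow> ('a \<Rightarrow> real) \<Rightarrow> (('a \<Rightarrow> real) \<times> ('a \<Rightarrow> real)) set" where
  "strong_whitney_entourage B e =
     {(f, g). f \<in> C_fun \<and> g \<in> C_fun \<and> (\<exists>\<delta>>0. \<forall>x\<in>enlarge B \<delta>. \<bar>f x - g x\<bar> < e x)}"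

definition whitney_uniformity ::
  "'a::metric_space set set \<Rightarrow> (('a \<Rightarrow> real) \<times> ('a \<Rightarrow> real)) filter" where
  "whitney_uniformity \<B> =
     (INF (B, e) \<in> \<B> \<times> C_pos. principal (whitney_entourage B e))"

definition strong_whitney_uniformity ::
  "'a::metric_space set set \<Rightarrow> (('a \<Rightarrow> real) \<times> ('a \<Rightarrow> real)) filter" where
  "strong_whitney_uniformity \<B> =
     (INF (B, e) \<in> \<B> \<times> C_pos. principal (strong_whitney_entourage B e))"

definition whitney_topology :: "'a::metric_space set set \<Rightarrow> ('a \<Rightarrow> real) topology" where
  "whitney_topology \<B> = uniformity_topology C_fun (whitney_uniformity \<B>)"

definition strong_whitney_topology :: "'a::metric_space set set \<Rightarrow> ('a \<Rightarrow> real) topology" where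
  "strong_whitney_topology \<B> = uniformity_topology C_fun (strong_whitney_uniformity \<B>)"

text \<open>For a bornology the filters above have the given entourages as a base, not just as a subbase.\<close>

lemma bornology_nonempty: "bornology \<B> \<Longrightarrow> \<B> \<noteq> {}"
  unfolding bornology_def by auto

lemma C_pos_min:
  assumes "e \<in> C_pos" "e' \<in> C_pos"
  shows "(\<lambda>x. min (e x) (e' x)) \<in> C_pos"
  using assms unfolding C_pos_def by (auto intro!: continuous_intros)

lemma C_pos_nonempty: "C_pos \<noteq> {}"
proof -
  have "(\<lambda>_. 1) \<in> C_pos" by (simp add: C_pos_def)
  then show ?thesis by blast
qed

lemma eventually_whitney_uniformity:
  assumes "bornology \<B>"
  shows "eventually P (whitney_uniformity \<B>) \<longleftrightarrow>
    (\<exists>B\<in>\<B>. \<exists>e\<in>C_pos. \<forall>p\<in>whitney_entourage B e. P p)"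
  unfolding whitney_uniformity_def
proof (subst eventually_INF_base, goal_cases)
  case 1
  show ?case using bornology_nonempty[OF assms] C_pos_nonempty by auto
next
  case (2 a b)
  then obtain B e B' e' where ab: "a = (B, e)" "b = (B', e')"
    and m: "B \<in> \<B>" "B' \<in> \<B>" "e \<in> C_pos" "e' \<in> C_pos" by auto
  have "B \<union> B' \<in> \<B>" using assms m by (auto simp: bornology_def)
  with m C_pos_min show ?case
    unfolding ab by (intro bexI[of _ "(B \<union> B', \<lambda>x. min (e x) (e' x))"])
      (auto simp: whitney_entourage_def)
next
  case 3
  show ?case by (simp add: eventually_principal)
qed

lemma eventually_strong_whitney_uniformity:
  assumes "bornology \<B>"
  shows "eventually P (strong_whitney_uniformity \<B>) \<longleftrightarrow>
    (\<exists>B\<in>\<B>. \<exists>e\<in>C_pos. \<forall>p\<in>strong_whitney_entourage B e. P p)"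
  unfolding strong_whitney_uniformity_def
proof (subst eventually_INF_base, goal_cases)
  case 1
  show ?case using bornology_nonempty[OF assms] C_pos_nonempty by auto
next
  case (2 a b)
  then obtain B e B' e' where ab: "a = (B, e)" "b = (B', e')"
    and m: "B \<in> \<B>" "B' \<in> \<B>" "e \<in> C_pos" "e' \<in> C_pos" by auto
  have "B \<union> B' \<in> \<B>" using assms m by (auto simp: bornology_def)
  with m C_pos_min show ?case
    unfolding ab by (intro bexI[of _ "(B \<union> B', \<lambda>x. min (e x) (e' x))"])
      (fastforce simp: strong_whitney_entourage_def enlarge_def)+
next
  case 3
  show ?case by (simp add: eventually_principal)
qed

lemma topspace_whitney_topology:
  assumes "bornology \<B>"
  shows "topspace (whitney_topology \<B>) = C_fun"
proof (rule antisym)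
  show "topspace (whitney_topology \<B>) \<subseteq> C_fun"
    unfolding whitney_topology_def
    by (rule openin_uniformity_topology[THEN iffD1, OF openin_topspace, THEN conjunct1])
  have "openin (whitney_topology \<B>) C_fun"
    using bornology_nonempty[OF assms] C_pos_nonempty
    by (fastforce simp: whitney_topology_def openin_uniformity_topology
        eventually_whitney_uniformity[OF assms] whitney_entourage_def)
  then show "C_fun \<subseteq> topspace (whitney_topology \<B>)" by (rule openin_subset)
qed

lemma topspace_strong_whitney_topology:
  assumes "bornology \<B>"
  shows "topspace (strong_whitney_topology \<B>) = C_fun"
proof (rule antisym)
  show "topspace (strong_whitney_topology \<B>) \<subseteq> C_fun"
    unfolding strong_whitney_topology_def
    by (rule openin_uniformity_topology[THEN iffD1, OF openin_topspace, THEN conjunct1])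
  have "openin (strong_whitney_topology \<B>) C_fun"
    using bornology_nonempty[OF assms] C_pos_nonempty
    by (fastforce simp: strong_whitney_topology_def openin_uniformity_topology
        eventually_strong_whitney_uniformity[OF assms] strong_whitney_entourage_def)
  then show "C_fun \<subseteq> topspace (strong_whitney_topology \<B>)" by (rule openin_subset)
qed

definition dominating :: "'a::metric_space set set \<Rightarrow> ('a \<Rightarrow> real) set \<Rightarrow> bool" where
  "dominating \<B> F \<longleftrightarrow>
     F \<subseteq> C_fun \<and> (\<forall>f\<in>C_fun. \<forall>B\<in>\<B>. \<exists>g\<in>F. \<forall>x\<in>B. f x \<le> g x)"

definition strongly_dominating :: "'a::metric_space set set \<Rightarrow> ('a \<Rightarrow> real) set \<Rightarrow> bool" where
  "strongly_dominating \<B> F \<longleftrightarrow>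
     F \<subseteq> C_fun \<and> (\<forall>f\<in>C_fun. \<forall>B\<in>\<B>. \<exists>g\<in>F. \<exists>\<delta>>0. \<forall>x\<in>enlarge B \<delta>. f x \<le> g x)"

definition dominating_number :: "'a::metric_space set set \<Rightarrow> (nat + ('a \<Rightarrow> real)) rel" where
  "dominating_number \<B> = natLeq +c least_card (\<lambda>m. \<exists>F. dominating \<B> F \<and> |F| =o m)"

definition strong_dominating_number ::
  "'a::metric_space set set \<Rightarrow> (nat + ('a \<Rightarrow> real)) rel" where
  "strong_dominating_number \<B> =
     natLeq +c least_card (\<lambda>m. \<exists>F. strongly_dominating \<B> F \<and> |F| =o m)"

definition open_cover :: "'a::metric_space set set \<Rightarrow> 'a set set \<Rightarrow> bool" where
  "open_cover \<B> \<G> \<longleftrightarrow> (\<forall>G\<in>\<G>. open G) \<and> (\<forall>B\<in>\<B>. \<exists>G\<in>\<G>. B \<subseteq> G)"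

definition strong_open_cover :: "'a::metric_space set set \<Rightarrow> 'a set set \<Rightarrow> bool" where
  "strong_open_cover \<B> \<G> \<longleftrightarrow>
     (\<forall>G\<in>\<G>. open G) \<and> (\<forall>B\<in>\<B>. \<exists>G\<in>\<G>. \<exists>\<delta>>0. enlarge B \<delta> \<subseteq> G)"

definition lindelof_number :: "'a::metric_space set set \<Rightarrow> (nat + 'a set) rel" where
  "lindelof_number \<B> = natLeq +c
     least_card (\<lambda>m. \<forall>\<G>. open_cover \<B> \<G> \<longrightarrow>
       (\<exists>\<G>0\<subseteq>\<G>. |\<G>0| \<le>o m \<and> open_cover \<B> \<G>0))"

definition strong_lindelof_number :: "'a::metric_space set set \<Rightarrow> (nat + 'a set) rel" where
  "strong_lindelof_number \<B> = natLeq +c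
     least_card (\<lambda>m. \<forall>\<G>. strong_open_cover \<B> \<G> \<longrightarrow>
       (\<exists>\<G>0\<subseteq>\<G>. |\<G>0| \<le>o m \<and> strong_open_cover \<B> \<G>0))"

definition tightness_at :: "'y \<Rightarrow> 'y topology \<Rightarrow> (nat + 'y) rel" where
  "tightness_at y Y = natLeq +c
     least_card (\<lambda>m. \<forall>C\<subseteq>topspace Y. y \<in> Y closure_of C \<longrightarrow>
       (\<exists>C0\<subseteq>C. |C0| \<le>o m \<and> y \<in> Y closure_of C0))"

text \<open>The supremum is the least cardinal that is an upper bound.\<close>

definition tightness :: "'y topology \<Rightarrow> (nat + 'y) rel" where
  "tightness Y = least_card (\<lambda>m. \<forall>y\<in>topspace Y. tightness_at y Y \<le>o m)"

end

theory Submission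
  imports Defs
begin

text \<open>
  Both topologies have the same shape.  Attach to each \<open>B\<close> a filter \<open>\<Phi> B\<close> on \<open>X\<close>: the principal
  filter of \<open>B\<close> for Whitney convergence, the filter generated by the enlargements \<open>B\<^sup>\<delta>\<close> for strong
  Whitney convergence.  Then \<open>f\<close> and \<open>g\<close> are \<open>(B, e)\<close>-close iff \<open>\<bar>f - g\<bar> < e\<close> holds eventually along
  \<open>\<Phi> B\<close>, and domination and covers are likewise statements about "eventually along \<open>\<Phi> B\<close>".  The
  equality is proved once, for such a family of filters.

  \<^emph>\<open>Tightness is at most the product.\<close>  Let \<open>f\<close> be in the closure of \<open>C\<close> and let \<open>F\<close> be a dominating
  family.  For \<open>d \<in> F\<close> put \<open>e\<^sub>d = 1 / max d 1\<close>.  The sets \<open>{x. \<bar>f x - g x\<bar> < e\<^sub>d x}\<close> with \<open>g \<in> C\<close> form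
  a cover, so for each \<open>d\<close> at most \<open>L\<close> functions \<open>g\<close> are enough to cover.  Collecting these over all
  \<open>d\<close> gives a set with \<open>f\<close> in its closure, because below any given positive continuous
  function there is, eventually along \<open>\<Phi> B\<close>, one of the \<open>e\<^sub>d\<close>.

  \<^emph>\<open>Tightness bounds both factors.\<close>  The zero function is in the closure of the set of positive
  continuous functions, and the reciprocals of any set of positive functions that accumulates at zero
  form a dominating family.  Given a cover \<open>\<G>\<close>, zero is also in the closure of the set of
  functions that are at least \<open>1\<close> off some \<open>G \<in> \<G>\<close>; if such functions accumulate at zero, then the
  corresponding sets \<open>G\<close> already form a cover.

  Only the last closure claim needs functions that vanish along \<open>\<Phi> B\<close> and are at least \<open>1\<close> off \<open>G\<close>.
  For enlargements the distance to \<open>B\<close> supplies them.  For \<open>B\<close> itself one first passes to a closed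
  superset of \<open>B\<close> in the bornology and then applies Urysohn's lemma; this is where the closed base
  enters.
\<close>

section \<open>Bounds on least cardinals\<close>

text \<open>
  A cardinal bound may live on a type different from the type of the candidates.  If it is too large
  to be represented there, then the largest candidate, \<^term>\<open>|UNIV|\<close>, is already below it.
\<close>

lemma least_card_ordLeq:
  fixes P :: "'c rel \<Rightarrow> bool" and k :: "'d rel"
  assumes k: "Card_order k" and top: "P |UNIV :: 'c set|"
    and P: "\<And>m :: 'c rel. Card_order m \<Longrightarrow> k =o m \<Longrightarrow> P m"
  shows "least_card P \<le>o k"
proof (cases "k \<le>o |UNIV :: 'c set|")
  case True
  then have "|Field k| \<le>o |UNIV :: 'c set|"
    by (rule ordIso_ordLeq_trans[OF card_of_Field_ordIso[OF k]])
  then obtain h :: "'d \<Rightarrow> 'c" where "inj_on h (Field k)"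
    by (auto simp: card_of_ordLeq[symmetric])
  then have "bij_betw h (Field k) (h ` Field k)" by (rule inj_on_imp_bij_betw)
  then have "|Field k| =o |h ` Field k|" by (rule card_of_ordIsoI)
  then have km: "k =o |h ` Field k|"
    by (rule ordIso_transitive[OF ordIso_symmetric[OF card_of_Field_ordIso[OF k]]])
  have "least_card P \<le>o |h ` Field k|"
    by (intro least_card(3)[where P = P, OF card_of_Card_order top] card_of_Card_order P km)
  then show ?thesis by (rule ordLeq_ordIso_trans[OF _ ordIso_symmetric[OF km]])
next
  case False
  have "Well_order k" "Well_order |UNIV :: 'c set|"
    using k card_of_Well_order unfolding card_order_on_def by blast+
  with False have "|UNIV :: 'c set| \<le>o k"
    using ordLeq_total by blast
  moreover have "least_card P \<le>o |UNIV :: 'c set|"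
    by (intro least_card(3)[where P = P, OF card_of_Card_order top] card_of_Card_order top)
  ultimately show ?thesis by (rule ordLeq_transitive[rotated])
qed

lemma Card_order_ordLeq_UNIV:
  fixes r :: "'c rel"
  assumes "Card_order r"
  shows "r \<le>o |UNIV :: 'c set|"
  by (rule ordIso_ordLeq_trans[OF ordIso_symmetric[OF card_of_Field_ordIso[OF assms]]])
    (rule card_of_mono1[OF subset_UNIV])

lemma Cinfinite_natLeq_csum: "Cinfinite (natLeq +c r)"
  by (simp add: Cinfinite_csum1 natLeq_Cinfinite)

text \<open>
  For a property that is inherited by larger cardinals and holds for \<^term>\<open>|UNIV|\<close>, the cardinal
  \<^term>\<open>natLeq +c least_card P\<close> is thus below every infinite cardinal, of whatever type, that has the
  property.
\<close>

lemma natLeq_csum_least_card_ordLeq: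
  fixes P :: "'c rel \<Rightarrow> bool" and k :: "'d rel"
  assumes k: "Cinfinite k" and top: "P |UNIV :: 'c set|"
    and P: "\<And>m :: 'c rel. Card_order m \<Longrightarrow> k =o m \<Longrightarrow> P m"
  shows "natLeq +c least_card P \<le>o k"
proof (rule csum_cinfinite_bound[OF _ _ natLeq_Card_order _ k])
  show "natLeq \<le>o k" using k by (intro natLeq_ordLeq_cinfinite)
  show "least_card P \<le>o k" by (rule least_card_ordLeq[where P = P, OF conjunct2[OF k] top P])
  show "Card_order (least_card P)" by (rule least_card(1)[where P = P, OF card_of_Card_order top])
qed

lemma least_card_ordLeq_csum:
  assumes "P |A|"
  shows "least_card P \<le>o natLeq +c least_card P"
  by (rule ordLeq_csum2[OF least_card(1)[where P = P, OF card_of_Card_order assms]])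

section \<open>Tightness\<close>

definition tightness_bound :: "'y \<Rightarrow> 'y topology \<Rightarrow> 'd rel \<Rightarrow> bool" where
  "tightness_bound y Y m \<longleftrightarrow> (\<forall>C\<subseteq>topspace Y. y \<in> Y closure_of C \<longrightarrow>
     (\<exists>C0\<subseteq>C. |C0| \<le>o m \<and> y \<in> Y closure_of C0))"

lemma tightness_bound_mono: "tightness_bound y Y m \<Longrightarrow> m \<le>o k \<Longrightarrow> tightness_bound y Y k"
  unfolding tightness_bound_def using ordLeq_transitive[of _ m k] by meson

lemma tightness_bound_UNIV:
  fixes Y :: "'y topology"
  shows "tightness_bound y Y |UNIV :: 'y set|"
  unfolding tightness_bound_def using card_of_mono1[OF subset_UNIV] by blast

lemma tightness_at_eq: "tightness_at y Y = natLeq +c least_card (tightness_bound y Y)"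
  unfolding tightness_at_def tightness_bound_def ..

lemma Cinfinite_tightness_at: "Cinfinite (tightness_at y Y)"
  unfolding tightness_at_def by (rule Cinfinite_natLeq_csum)

lemma tightness_at_ordLeq_UNIV:
  "\<forall>y\<in>topspace Y. tightness_at y (Y :: 'y topology) \<le>o |UNIV :: (nat + 'y) set|"
  by (intro ballI Card_order_ordLeq_UNIV conjunct2[OF Cinfinite_tightness_at])

lemma tightness_ordLeq:
  fixes Y :: "'y topology" and k :: "'d rel"
  assumes k: "Cinfinite k" and bound: "\<And>y. y \<in> topspace Y \<Longrightarrow> tightness_bound y Y k"
  shows "tightness Y \<le>o k"
proof -
  have at: "tightness_at y Y \<le>o k" if y: "y \<in> topspace Y" for y
    unfolding tightness_at_eq
    by (rule natLeq_csum_least_card_ordLeq[where P = "tightness_bound y Y", OF k tightness_bound_UNIV])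
      (rule tightness_bound_mono[OF bound[OF y] ordIso_imp_ordLeq])
  show ?thesis
    unfolding tightness_def
  proof (rule least_card_ordLeq[where P = "\<lambda>m. \<forall>y\<in>topspace Y. tightness_at y Y \<le>o m",
        OF conjunct2[OF k] tightness_at_ordLeq_UNIV])
    show "\<forall>y\<in>topspace Y. tightness_at y Y \<le>o m" if "k =o m" for m :: "(nat + 'y) rel"
      using that by (intro ballI ordLeq_ordIso_trans[OF at])
  qed
qed

lemma tightness_at_ordLeq_tightness:
  assumes "y \<in> topspace Y"
  shows "tightness_at y Y \<le>o tightness Y"
  using least_card(2)[where P = "\<lambda>m. \<forall>y\<in>topspace Y. tightness_at y Y \<le>o m",
      OF card_of_Card_order tightness_at_ordLeq_UNIV] assms
  unfolding tightness_def by (rule bspec)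

lemma Cinfinite_tightness:
  assumes "y \<in> topspace Y"
  shows "Cinfinite (tightness Y)"
proof
  show "cinfinite (tightness Y)"
    by (rule cinfinite_mono[OF tightness_at_ordLeq_tightness[OF assms]
          conjunct1[OF Cinfinite_tightness_at]])
  show "Card_order (tightness Y)"
    unfolding tightness_def
    by (rule least_card(1)[where P = "\<lambda>m. \<forall>y\<in>topspace Y. tightness_at y Y \<le>o m",
          OF card_of_Card_order tightness_at_ordLeq_UNIV])
qed

lemma closure_of_tightness:
  fixes Y :: "'y topology"
  assumes C: "C \<subseteq> topspace Y" and y: "y \<in> Y closure_of C"
  obtains C0 where "C0 \<subseteq> C" "|C0| \<le>o tightness Y" "y \<in> Y closure_of C0"
proof -
  let ?P = "tightness_bound y Y :: 'y rel \<Rightarrow> bool"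
  have "tightness_bound y Y (least_card ?P)"
    by (rule least_card(2)[where P = ?P, OF card_of_Card_order tightness_bound_UNIV])
  moreover have "least_card ?P \<le>o tightness_at y Y"
    unfolding tightness_at_eq by (rule least_card_ordLeq_csum[where P = ?P, OF tightness_bound_UNIV])
  moreover have "y \<in> topspace Y" using y in_closure_of by fast
  ultimately have "tightness_bound y Y (tightness Y)"
    by (intro tightness_bound_mono[OF tightness_bound_mono tightness_at_ordLeq_tightness])
  with C y that show ?thesis unfolding tightness_bound_def by blast
qed

section \<open>Reciprocals of continuous functions\<close>

lemma inverse_C_fun:
  assumes "g \<in> C_pos"
  shows "(\<lambda>x. 1 / g x) \<in> C_fun"
proof -
  have "continuous_on UNIV g" "\<forall>x. g x \<noteq> 0"
    using assms unfolding C_pos_def by (auto simp: less_le)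
  then show ?thesis unfolding C_fun_def by (auto intro: continuous_on_divide continuous_on_const)
qed

text \<open>
  Cutting off at \<open>1\<close> makes the reciprocal a legitimate tolerance; it can only increase \<open>f\<close>, hence only
  tighten the tolerance.
\<close>

lemma inverse_max_C_pos:
  assumes "f \<in> C_fun"
  shows "(\<lambda>x. 1 / max (f x) 1) \<in> C_pos"
proof -
  have pos: "0 < max (f x) 1" for x by (simp add: less_max_iff_disj)
  have "continuous_on UNIV (\<lambda>x. max (f x) 1)"
    using assms unfolding C_fun_def by (auto intro: continuous_on_max continuous_on_const)
  then have "(\<lambda>x. max (f x) 1) \<in> C_pos" using pos by (simp add: C_pos_def)
  then have "(\<lambda>x. 1 / max (f x) 1) \<in> C_fun" by (rule inverse_C_fun)
  then show ?thesis using pos unfolding C_fun_def C_pos_def by simp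
qed

section \<open>Convergence along a family of filters\<close>

text \<open>
  The assumption \<open>separation\<close> translates covers into functions: small along the filter of \<open>B\<close>, large off
  a member of the cover.
\<close>

locale filter_whitney =
  fixes \<B> :: "'a::metric_space set set"
    and \<Phi> :: "'a set \<Rightarrow> 'a filter"
    and \<U> :: "(('a \<Rightarrow> real) \<times> ('a \<Rightarrow> real)) filter"
  assumes nonempty: "\<B> \<noteq> {}"
    and eventually_unif: "\<And>P. eventually P \<U> \<longleftrightarrow>
      (\<exists>B\<in>\<B>. \<exists>e\<in>C_pos. \<forall>f\<in>C_fun. \<forall>g\<in>C_fun.
        (\<forall>\<^sub>F x in \<Phi> B. \<bar>f x - g x\<bar> < e x) \<longrightarrow> P (f, g))"
    and separation: "\<And>\<G> B. (\<forall>G\<in>\<G>. open G) \<Longrightarrow>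
      (\<forall>B\<in>\<B>. \<exists>G\<in>\<G>. \<forall>\<^sub>F x in \<Phi> B. x \<in> G) \<Longrightarrow> B \<in> \<B> \<Longrightarrow>
      \<exists>G\<in>\<G>. \<exists>h\<in>C_fun. (\<forall>\<^sub>F x in \<Phi> B. h x = 0) \<and> (\<forall>x. x \<notin> G \<longrightarrow> 1 \<le> h x)"
begin

abbreviation Y :: "('a \<Rightarrow> real) topology" where
  "Y \<equiv> uniformity_topology C_fun \<U>"

definition dom_family :: "('a \<Rightarrow> real) set \<Rightarrow> bool" where
  "dom_family F \<longleftrightarrow>
     F \<subseteq> C_fun \<and> (\<forall>f\<in>C_fun. \<forall>B\<in>\<B>. \<exists>g\<in>F. \<forall>\<^sub>F x in \<Phi> B. f x \<le> g x)"

definition cover :: "'a set set \<Rightarrow> bool" where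
  "cover \<G> \<longleftrightarrow> (\<forall>G\<in>\<G>. open G) \<and> (\<forall>B\<in>\<B>. \<exists>G\<in>\<G>. \<forall>\<^sub>F x in \<Phi> B. x \<in> G)"

definition cover_bound :: "'d rel \<Rightarrow> bool" where
  "cover_bound m \<longleftrightarrow> (\<forall>\<G>. cover \<G> \<longrightarrow> (\<exists>\<G>0\<subseteq>\<G>. |\<G>0| \<le>o m \<and> cover \<G>0))"

definition dom_number :: "(nat + ('a \<Rightarrow> real)) rel" where
  "dom_number = natLeq +c least_card (\<lambda>m. \<exists>F. dom_family F \<and> |F| =o m)"

definition cover_number :: "(nat + 'a set) rel" where
  "cover_number = natLeq +c least_card cover_bound"

lemma topspace_Y: "topspace Y = C_fun"
proof (rule antisym)
  show "topspace Y \<subseteq> C_fun"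
    by (rule openin_uniformity_topology[THEN iffD1, OF openin_topspace, THEN conjunct1])
  have "openin Y C_fun"
    using nonempty C_pos_nonempty
    unfolding openin_uniformity_topology eventually_unif by fast
  then show "C_fun \<subseteq> topspace Y" by (rule openin_subset)
qed

text \<open>
  The functions close to \<open>f\<close> form a neighbourhood of \<open>f\<close>, though perhaps not an open one; its
  interior is found by halving the tolerance.
\<close>

lemma in_closure_of_Y:
  assumes f: "f \<in> C_fun" and C: "C \<subseteq> C_fun"
  shows "f \<in> Y closure_of C \<longleftrightarrow>
    (\<forall>B\<in>\<B>. \<forall>e\<in>C_pos. \<exists>g\<in>C. \<forall>\<^sub>F x in \<Phi> B. \<bar>f x - g x\<bar> < e x)"
proof (intro iffI ballI)
  fix B and e :: "'a \<Rightarrow> real"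
  assume cl: "f \<in> Y closure_of C" and B: "B \<in> \<B>" and e: "e \<in> C_pos"
  define U where "U = {h \<in> C_fun. \<exists>e'\<in>C_pos. \<forall>k\<in>C_fun.
    (\<forall>\<^sub>F x in \<Phi> B. \<bar>h x - k x\<bar> < e' x) \<longrightarrow> (\<forall>\<^sub>F x in \<Phi> B. \<bar>f x - k x\<bar> < e x)}"
  have "openin Y U"
    unfolding openin_uniformity_topology
  proof (intro conjI ballI)
    show "U \<subseteq> C_fun" by (auto simp: U_def)
    fix h assume "h \<in> U"
    then obtain e' where h: "h \<in> C_fun" and e': "e' \<in> C_pos"
      and imp: "\<And>k. k \<in> C_fun \<Longrightarrow> \<forall>\<^sub>F x in \<Phi> B. \<bar>h x - k x\<bar> < e' x \<Longrightarrow>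
        \<forall>\<^sub>F x in \<Phi> B. \<bar>f x - k x\<bar> < e x"
      by (auto simp: U_def)
    have half: "(\<lambda>x. e' x / 2) \<in> C_pos"
      using e' by (auto simp: C_pos_def intro!: continuous_intros)
    have "g \<in> U" if g: "g \<in> C_fun" and hg: "\<forall>\<^sub>F x in \<Phi> B. \<bar>h x - g x\<bar> < e' x / 2" for g
    proof -
      have near: "\<forall>\<^sub>F x in \<Phi> B. \<bar>f x - k x\<bar> < e x"
        if k: "k \<in> C_fun" and gk: "\<forall>\<^sub>F x in \<Phi> B. \<bar>g x - k x\<bar> < e' x / 2" for k
      proof (rule imp[OF k])
        show "\<forall>\<^sub>F x in \<Phi> B. \<bar>h x - k x\<bar> < e' x"
          using hg gk by eventually_elim linarith
      qed
      show ?thesis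
        unfolding U_def by (intro CollectI conjI g bexI[OF _ half] ballI impI near)
    qed
    then show "eventually (\<lambda>(f', g). f' = h \<longrightarrow> g \<in> U) \<U>"
      unfolding eventually_unif
      by (intro bexI[OF _ B] bexI[OF _ half]) auto
  qed
  moreover have "f \<in> U" using f e by (auto simp: U_def)
  ultimately obtain g where g: "g \<in> C" "g \<in> U"
    using cl unfolding in_closure_of by blast
  then have "\<forall>\<^sub>F x in \<Phi> B. \<bar>f x - g x\<bar> < e x"
    by (auto simp: U_def C_pos_def)
  with g show "\<exists>g\<in>C. \<forall>\<^sub>F x in \<Phi> B. \<bar>f x - g x\<bar> < e x" by blast
next
  assume *: "\<forall>B\<in>\<B>. \<forall>e\<in>C_pos. \<exists>g\<in>C. \<forall>\<^sub>F x in \<Phi> B. \<bar>f x - g x\<bar> < e x"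
  have "\<exists>g\<in>C. g \<in> T" if T: "f \<in> T" "openin Y T" for T
  proof -
    have "eventually (\<lambda>(f', g). f' = f \<longrightarrow> g \<in> T) \<U>"
      using T unfolding openin_uniformity_topology by blast
    then obtain B e where "B \<in> \<B>" "e \<in> C_pos"
      and "\<And>g. g \<in> C_fun \<Longrightarrow> \<forall>\<^sub>F x in \<Phi> B. \<bar>f x - g x\<bar> < e x \<Longrightarrow> g \<in> T"
      using f unfolding eventually_unif by blast
    with * C show ?thesis by blast
  qed
  then show "f \<in> Y closure_of C"
    unfolding in_closure_of topspace_Y using f by (intro conjI allI impI) (auto simp: Bex_def)
qed

lemma closure_of_Y_obtain:
  assumes "f \<in> Y closure_of C" "C \<subseteq> C_fun" "B \<in> \<B>" "e \<in> C_pos"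
  obtains g where "g \<in> C" "\<forall>\<^sub>F x in \<Phi> B. \<bar>f x - g x\<bar> < e x"
proof -
  have f: "f \<in> C_fun"
    using subsetD[OF closure_of_subset_topspace assms(1)] by (simp add: topspace_Y)
  have "\<forall>B\<in>\<B>. \<forall>e\<in>C_pos. \<exists>g\<in>C. \<forall>\<^sub>F x in \<Phi> B. \<bar>f x - g x\<bar> < e x"
    by (rule iffD1[OF in_closure_of_Y[OF f assms(2)] assms(1)])
  then have "\<exists>g\<in>C. \<forall>\<^sub>F x in \<Phi> B. \<bar>f x - g x\<bar> < e x"
    by (rule bspec[OF bspec[OF _ assms(3)] assms(4)])
  with that show ?thesis by blast
qed

lemma dom_family_obtain:
  assumes "dom_family F" "f \<in> C_fun" "B \<in> \<B>"
  obtains d where "d \<in> F" "\<forall>\<^sub>F x in \<Phi> B. f x \<le> d x"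
  using assms unfolding dom_family_def by blast

lemma C_fun_dom_family: "dom_family C_fun"
  unfolding dom_family_def by (auto intro!: always_eventually)

lemma dom_number_ordLeq:
  assumes "dom_family F" "|F| \<le>o k" "Cinfinite k"
  shows "dom_number \<le>o k"
proof -
  let ?P = "\<lambda>m :: ('a \<Rightarrow> real) rel. \<exists>F. dom_family F \<and> |F| =o m"
  have P: "?P |F|" using assms(1) card_of_refl by blast
  have "least_card ?P \<le>o |F|"
    by (rule least_card(3)[where P = ?P, OF card_of_Card_order P card_of_Card_order P])
  then have "least_card ?P \<le>o k" by (rule ordLeq_transitive[OF _ assms(2)])
  moreover have "natLeq \<le>o k" using assms(3) by (intro natLeq_ordLeq_cinfinite)
  ultimately show ?thesis
    unfolding dom_number_def
    by (intro csum_cinfinite_bound[OF _ _ natLeq_Card_order _ assms(3)]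
        least_card(1)[where P = ?P, OF card_of_Card_order P])
qed

lemma dom_number_witness:
  obtains F where "dom_family F" "|F| \<le>o dom_number"
proof -
  let ?P = "\<lambda>m :: ('a \<Rightarrow> real) rel. \<exists>F. dom_family F \<and> |F| =o m"
  have P: "?P |C_fun|" using C_fun_dom_family card_of_refl by blast
  obtain F where F: "dom_family F" "|F| =o least_card ?P"
    using least_card(2)[where P = ?P, OF card_of_Card_order P] by blast
  have "least_card ?P \<le>o dom_number"
    unfolding dom_number_def by (rule least_card_ordLeq_csum[where P = ?P, OF P])
  then show ?thesis by (intro that[OF F(1)] ordIso_ordLeq_trans[OF F(2)])
qed

lemma cover_bound_mono: "cover_bound m \<Longrightarrow> m \<le>o k \<Longrightarrow> cover_bound k"
  unfolding cover_bound_def using ordLeq_transitive[of _ m k] by meson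

lemma cover_bound_UNIV: "cover_bound |UNIV :: 'a set set|"
  unfolding cover_bound_def using card_of_mono1[OF subset_UNIV] by blast

lemma cover_number_ordLeq:
  assumes k: "Cinfinite k" and bound: "cover_bound k"
  shows "cover_number \<le>o k"
  unfolding cover_number_def
  by (rule natLeq_csum_least_card_ordLeq[where P = cover_bound, OF k cover_bound_UNIV])
    (rule cover_bound_mono[OF bound ordIso_imp_ordLeq])

lemma cover_bound_cover_number: "cover_bound cover_number"
  unfolding cover_number_def
  by (rule cover_bound_mono[OF least_card(2)[where P = cover_bound]
        least_card_ordLeq_csum[where P = cover_bound]])
    (rule card_of_Card_order cover_bound_UNIV)+

text \<open>
  For a fixed tolerance \<open>e\<close>, accumulation of \<open>C\<close> at \<open>f\<close> says that the sets where \<open>\<bar>f - g\<bar> < e\<close> form a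
  cover; a small subcover selects a small part of \<open>C\<close> that still meets every neighbourhood with
  this tolerance.
\<close>

lemma closure_of_fixed_tolerance:
  assumes f: "f \<in> C_fun" and C: "C \<subseteq> C_fun" and cl: "f \<in> Y closure_of C" and e: "e \<in> C_pos"
  shows "\<exists>C0\<subseteq>C. |C0| \<le>o cover_number \<and>
    (\<forall>B\<in>\<B>. \<exists>g\<in>C0. \<forall>\<^sub>F x in \<Phi> B. \<bar>f x - g x\<bar> < e x)"
proof -
  define V where "V g = {x. \<bar>f x - g x\<bar> < e x}" for g
  have "open (V g)" if "g \<in> C" for g
    using that C f e unfolding V_def
    by (intro open_Collect_less continuous_intros) (auto simp: C_fun_def C_pos_def)
  moreover have "\<exists>G\<in>V ` C. \<forall>\<^sub>F x in \<Phi> B. x \<in> G" if "B \<in> \<B>" for B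
    using that cl e unfolding in_closure_of_Y[OF f C] V_def by auto
  ultimately have "cover (V ` C)" by (auto simp: cover_def)
  then obtain \<G>0 where \<G>0: "\<G>0 \<subseteq> V ` C" "|\<G>0| \<le>o cover_number" "cover \<G>0"
    using cover_bound_cover_number unfolding cover_bound_def by blast
  define s where "s = inv_into C V"
  have s: "s G \<in> C" "V (s G) = G" if "G \<in> \<G>0" for G
  proof -
    have "G \<in> V ` C" using that \<G>0(1) by (rule rev_subsetD)
    then show "s G \<in> C" "V (s G) = G"
      unfolding s_def by (rule inv_into_into, rule f_inv_into_f)
  qed
  have "s ` \<G>0 \<subseteq> C" using s by blast
  moreover have "|s ` \<G>0| \<le>o cover_number"
    by (rule ordLeq_transitive[OF card_of_image \<G>0(2)])
  moreover have "\<exists>g\<in>s ` \<G>0. \<forall>\<^sub>F x in \<Phi> B. \<bar>f x - g x\<bar> < e x" if "B \<in> \<B>" for B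
  proof -
    have "\<exists>G\<in>\<G>0. \<forall>\<^sub>F x in \<Phi> B. x \<in> G"
      using \<G>0(3) that by (simp add: cover_def)
    then obtain G where G: "G \<in> \<G>0" "\<forall>\<^sub>F x in \<Phi> B. x \<in> G" by (rule bexE)
    have "\<forall>\<^sub>F x in \<Phi> B. x \<in> V (s G)" unfolding s(2)[OF G(1)] by (rule G(2))
    then show ?thesis
      unfolding V_def mem_Collect_eq bex_simps by (rule bexI[OF _ G(1)])
  qed
  ultimately show ?thesis by blast
qed

text \<open>
  The tolerances \<open>1 / max d 1\<close>, for \<open>d\<close> in a dominating family, are cofinal among all tolerances along
  each filter, so it is enough to treat them one at a time and to unite the resulting small sets.
\<close>

theorem tightness_ordLeq_product: "tightness Y \<le>o dom_number *c cover_number"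
proof -
  have dn: "Cinfinite dom_number" and L: "Cinfinite cover_number"
    unfolding dom_number_def cover_number_def by (rule Cinfinite_natLeq_csum)+
  have prod: "Cinfinite (dom_number *c cover_number)"
    using dn L by (intro Cinfinite_cprod2 Cinfinite_Cnotzero)
  show ?thesis
  proof (rule tightness_ordLeq[OF prod])
    fix f assume "f \<in> topspace Y"
    then have f: "f \<in> C_fun" by (simp add: topspace_Y)
    show "tightness_bound f Y (dom_number *c cover_number)"
      unfolding tightness_bound_def topspace_Y
    proof (intro allI impI)
      fix C assume C: "C \<subseteq> C_fun" and cl: "f \<in> Y closure_of C"
      obtain F where F: "dom_family F" "|F| \<le>o dom_number"
        by (rule dom_number_witness)
      define e where "e d x = 1 / max (d x) 1" for d :: "'a \<Rightarrow> real" and x :: 'a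
      have epos: "e d \<in> C_pos" if "d \<in> F" for d
        using that F(1) unfolding e_def dom_family_def by (intro inverse_max_C_pos) blast
      have "\<forall>d\<in>F. \<exists>C0\<subseteq>C. |C0| \<le>o cover_number \<and>
          (\<forall>B\<in>\<B>. \<exists>g\<in>C0. \<forall>\<^sub>F x in \<Phi> B. \<bar>f x - g x\<bar> < e d x)"
        using closure_of_fixed_tolerance[OF f C cl epos] by blast
      then obtain c where *: "\<forall>d\<in>F. c d \<subseteq> C \<and> |c d| \<le>o cover_number \<and>
          (\<forall>B\<in>\<B>. \<exists>g\<in>c d. \<forall>\<^sub>F x in \<Phi> B. \<bar>f x - g x\<bar> < e d x)"
        by (rule bchoice[THEN exE])
      have c: "c d \<subseteq> C" "|c d| \<le>o cover_number" if "d \<in> F" for d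
        using bspec[OF * that] by simp_all
      have near: "\<exists>g\<in>c d. \<forall>\<^sub>F x in \<Phi> B. \<bar>f x - g x\<bar> < e d x"
        if "d \<in> F" "B \<in> \<B>" for d B
        using bspec[OF * that(1)] that(2) by simp
      let ?C0 = "\<Union>d\<in>F. c d"
      have sub: "?C0 \<subseteq> C" using c by blast
      have "|F| \<le>o dom_number *c cover_number"
        by (rule ordLeq_transitive[OF F(2)
              ordLeq_ordIso_trans[OF ordLeq_cprod2[OF Cinfinite_Cnotzero[OF L] conjunct2[OF dn]]
              cprod_com]])
      moreover have "|c d| \<le>o dom_number *c cover_number" if "d \<in> F" for d
        by (rule ordLeq_transitive[OF c(2)[OF that]
              ordLeq_cprod2[OF Cinfinite_Cnotzero[OF dn] conjunct2[OF L]]])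
      ultimately have "|?C0| \<le>o dom_number *c cover_number"
        by (intro UNION_Cinfinite_bound[OF _ _ prod]) blast+
      moreover have "f \<in> Y closure_of ?C0"
        unfolding in_closure_of_Y[OF f subset_trans[OF sub C]]
      proof (intro ballI)
        fix B and \<epsilon> :: "'a \<Rightarrow> real" assume B: "B \<in> \<B>" and \<epsilon>: "\<epsilon> \<in> C_pos"
        have pos: "0 < \<epsilon> x" for x using \<epsilon> by (auto simp: C_pos_def)
        have "(\<lambda>x. 1 / \<epsilon> x) \<in> C_fun" by (rule inverse_C_fun[OF \<epsilon>])
        then obtain d where d: "d \<in> F" "\<forall>\<^sub>F x in \<Phi> B. 1 / \<epsilon> x \<le> d x"
          by (rule dom_family_obtain[OF F(1) _ B])
        obtain g where g: "g \<in> c d" "\<forall>\<^sub>F x in \<Phi> B. \<bar>f x - g x\<bar> < e d x"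
          using near[OF d(1) B] by blast
        have le: "e d x \<le> \<epsilon> x" if "1 / \<epsilon> x \<le> d x" for x
        proof -
          have "1 / max (d x) 1 \<le> 1 / (1 / \<epsilon> x)"
            using that pos[of x] by (intro divide_left_mono) auto
          then show ?thesis by (simp add: e_def)
        qed
        have "\<forall>\<^sub>F x in \<Phi> B. \<bar>f x - g x\<bar> < \<epsilon> x"
          using d(2) g(2) by eventually_elim (use le in force)
        with d g show "\<exists>g\<in>?C0. \<forall>\<^sub>F x in \<Phi> B. \<bar>f x - g x\<bar> < \<epsilon> x" by blast
      qed
      ultimately show "\<exists>C0\<subseteq>C. |C0| \<le>o dom_number *c cover_number \<and> f \<in> Y closure_of C0"
        using sub by blast
    qed
  qed
qed

lemma zero_in_C_fun: "(\<lambda>_. 0) \<in> C_fun"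
  by (simp add: C_fun_def)

lemma Cinfinite_tightness_Y: "Cinfinite (tightness Y)"
  by (rule Cinfinite_tightness[where y = "\<lambda>_. 0"]) (subst topspace_Y, rule zero_in_C_fun)

text \<open>
  A positive function below the tolerance \<open>1 / max f 1\<close> has its reciprocal above \<open>f\<close>.  So small positive
  functions, of which zero is a limit, turn into dominating ones.
\<close>

theorem dom_number_ordLeq_tightness: "dom_number \<le>o tightness Y"
proof -
  have pos_sub: "C_pos \<subseteq> (C_fun :: ('a \<Rightarrow> real) set)" by (auto simp: C_pos_def C_fun_def)
  have "(\<lambda>_. 0) \<in> Y closure_of C_pos"
    unfolding in_closure_of_Y[OF zero_in_C_fun pos_sub]
  proof (intro ballI)
    fix B and e :: "'a \<Rightarrow> real" assume e: "e \<in> C_pos"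
    then have "(\<lambda>x. e x / 2) \<in> C_pos"
      by (auto simp: C_pos_def intro!: continuous_intros)
    moreover have "\<bar>0 - e x / 2\<bar> < e x" for x
      using e by (auto simp: C_pos_def abs_if)
    ultimately show "\<exists>g\<in>C_pos. \<forall>\<^sub>F x in \<Phi> B. \<bar>0 - g x\<bar> < e x"
      by (intro bexI[of _ "\<lambda>x. e x / 2"] always_eventually) auto
  qed
  then obtain C0 where C0: "C0 \<subseteq> C_pos" "|C0| \<le>o tightness Y" "(\<lambda>_. 0) \<in> Y closure_of C0"
    using closure_of_tightness[of C_pos Y] pos_sub topspace_Y by metis
  let ?F = "(\<lambda>g x. 1 / g x) ` C0"
  have "dom_family ?F"
    unfolding dom_family_def
  proof (intro conjI ballI)
    show "?F \<subseteq> C_fun"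
      using C0(1) by (intro image_subsetI inverse_C_fun) blast
    fix f :: "'a \<Rightarrow> real" and B assume f: "f \<in> C_fun" and B: "B \<in> \<B>"
    have "(\<lambda>x. 1 / max (f x) 1) \<in> C_pos" by (rule inverse_max_C_pos[OF f])
    then obtain g where g: "g \<in> C0" "\<forall>\<^sub>F x in \<Phi> B. \<bar>0 - g x\<bar> < 1 / max (f x) 1"
      by (rule closure_of_Y_obtain[OF C0(3) subset_trans[OF C0(1) pos_sub] B])
    have le: "f x \<le> 1 / g x" if "\<bar>0 - g x\<bar> < 1 / max (f x) 1" for x
    proof -
      have "0 < g x" using g C0(1) by (auto simp: C_pos_def)
      moreover have "0 < max (f x) 1" by (simp add: less_max_iff_disj)
      moreover have "b \<le> 1 / a" if "0 < a" "0 < b" "\<bar>0 - a\<bar> < 1 / b" for a b :: real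
        using that by (simp add: field_simps)
      ultimately have "max (f x) 1 \<le> 1 / g x" using that by blast
      then show ?thesis by simp
    qed
    have "\<forall>\<^sub>F x in \<Phi> B. f x \<le> 1 / g x"
      using g(2) by eventually_elim (rule le)
    then show "\<exists>g\<in>?F. \<forall>\<^sub>F x in \<Phi> B. f x \<le> g x"
      unfolding bex_simps by (rule bexI[OF _ g(1)])
  qed
  then show ?thesis
    by (rule dom_number_ordLeq[OF _ _ Cinfinite_tightness_Y])
      (rule ordLeq_transitive[OF card_of_image C0(2)])
qed

text \<open>
  A function that is at least \<open>1\<close> off \<open>G\<close> can be smaller than \<open>1\<close> along \<open>\<Phi> B\<close> only if \<open>G\<close> belongs to
  \<open>\<Phi> B\<close>.  So a set of such functions that accumulates at zero picks out a subcover.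
\<close>

theorem cover_number_ordLeq_tightness: "cover_number \<le>o tightness Y"
proof (rule cover_number_ordLeq[OF Cinfinite_tightness_Y], unfold cover_bound_def, intro allI impI)
  fix \<G> assume cov: "cover \<G>"
  define C where "C = {h \<in> C_fun. \<exists>G\<in>\<G>. \<forall>x. x \<notin> G \<longrightarrow> 1 \<le> h x}"
  have C: "C \<subseteq> C_fun" by (auto simp: C_def)
  have "(\<lambda>_. 0) \<in> Y closure_of C"
    unfolding in_closure_of_Y[OF zero_in_C_fun C]
  proof (intro ballI)
    fix B and e :: "'a \<Rightarrow> real" assume B: "B \<in> \<B>" and e: "e \<in> C_pos"
    obtain G h where h: "G \<in> \<G>" "h \<in> C_fun" "\<forall>\<^sub>F x in \<Phi> B. h x = 0" "\<forall>x. x \<notin> G \<longrightarrow> 1 \<le> h x"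
      using separation[OF conjunct1[OF cov[unfolded cover_def]]
          conjunct2[OF cov[unfolded cover_def]] B] by blast
    have "\<forall>\<^sub>F x in \<Phi> B. \<bar>0 - h x\<bar> < e x"
      using h(3) by eventually_elim (use e in \<open>simp add: C_pos_def\<close>)
    with h show "\<exists>g\<in>C. \<forall>\<^sub>F x in \<Phi> B. \<bar>0 - g x\<bar> < e x" by (auto simp: C_def)
  qed
  then obtain C0 where C0: "C0 \<subseteq> C" "|C0| \<le>o tightness Y" "(\<lambda>_. 0) \<in> Y closure_of C0"
    using closure_of_tightness[of C Y] C topspace_Y by metis
  have "\<forall>h\<in>C0. \<exists>G\<in>\<G>. \<forall>x. x \<notin> G \<longrightarrow> 1 \<le> h x" using C0(1) by (auto simp: C_def)
  then obtain \<gamma> where \<gamma>: "\<And>h. h \<in> C0 \<Longrightarrow> \<gamma> h \<in> \<G>"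
      "\<And>h x. h \<in> C0 \<Longrightarrow> x \<notin> \<gamma> h \<Longrightarrow> 1 \<le> h x"
    by metis
  have "\<exists>G\<in>\<gamma> ` C0. \<forall>\<^sub>F x in \<Phi> B. x \<in> G" if B: "B \<in> \<B>" for B
  proof -
    have "(\<lambda>_. 1) \<in> (C_pos :: ('a \<Rightarrow> real) set)" by (simp add: C_pos_def)
    then obtain h where h: "h \<in> C0" "\<forall>\<^sub>F x in \<Phi> B. \<bar>0 - h x\<bar> < 1"
      by (rule closure_of_Y_obtain[OF C0(3) subset_trans[OF C0(1) C] B])
    have "\<forall>\<^sub>F x in \<Phi> B. x \<in> \<gamma> h"
      using h(2) by eventually_elim (use \<gamma>(2)[OF h(1)] in force)
    with h show ?thesis by blast
  qed
  with \<gamma>(1) cov have "cover (\<gamma> ` C0)" by (auto simp: cover_def)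
  moreover have "|\<gamma> ` C0| \<le>o tightness Y" by (rule ordLeq_transitive[OF card_of_image C0(2)])
  ultimately show "\<exists>\<G>0\<subseteq>\<G>. |\<G>0| \<le>o tightness Y \<and> cover \<G>0"
    using \<gamma>(1) by (intro exI[of _ "\<gamma> ` C0"]) auto
qed

theorem tightness_ordIso_product: "tightness Y =o dom_number *c cover_number"
proof -
  have "Card_order dom_number" "Card_order cover_number"
    unfolding dom_number_def cover_number_def using Cinfinite_natLeq_csum by blast+
  then have "dom_number *c cover_number \<le>o tightness Y"
    by (intro cprod_cinfinite_bound dom_number_ordLeq_tightness cover_number_ordLeq_tightness
        Cinfinite_tightness_Y)
  with tightness_ordLeq_product show ?thesis by (simp add: ordIso_iff_ordLeq)
qed

end

section \<open>Whitney and strong Whitney convergence\<close>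

definition enlargement_filter :: "'a::metric_space set \<Rightarrow> 'a filter" where
  "enlargement_filter B = (INF \<delta>\<in>{0<..}. principal (enlarge B \<delta>))"

lemma eventually_enlargement_filter:
  "eventually P (enlargement_filter B) \<longleftrightarrow> (\<exists>\<delta>>0. \<forall>x\<in>enlarge B \<delta>. P x)"
  unfolding enlargement_filter_def
proof (subst eventually_INF_base, goal_cases)
  case 1
  show ?case by (auto intro: exI[of _ 1])
next
  case (2 a b)
  then show ?case
    by (intro bexI[of _ "min a b"]) (auto simp: enlarge_def)
next
  case 3
  show ?case by (auto simp: eventually_principal)
qed

text \<open>
  The function is constantly \<open>0\<close> up to distance \<open>\<delta> / 2\<close> from \<open>B\<close> and reaches \<open>1\<close> at distance \<open>\<delta>\<close>.
\<close>

lemma enlargement_separation: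
  fixes B :: "'a::metric_space set"
  assumes "B \<noteq> {}" "0 < \<delta>" "enlarge B \<delta> \<subseteq> G"
  shows "\<exists>h\<in>C_fun. (\<forall>\<^sub>F x in enlargement_filter B. h x = 0) \<and> (\<forall>x. x \<notin> G \<longrightarrow> 1 \<le> h x)"
proof -
  define h where "h x = max 0 (2 * infdist x B / \<delta> - 1)" for x
  have "h \<in> C_fun"
    using \<open>0 < \<delta>\<close> unfolding C_fun_def h_def by (auto intro!: continuous_intros)
  moreover have "h x = 0" if x: "x \<in> enlarge B (\<delta> / 2)" for x
  proof -
    obtain b where b: "b \<in> B" "dist b x < \<delta> / 2" using x by (auto simp: enlarge_def)
    then have "infdist x B < \<delta> / 2"
      using infdist_le[OF b(1), of x] by (simp add: dist_commute)
    then show ?thesis using \<open>0 < \<delta>\<close> by (simp add: h_def field_simps)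
  qed
  then have "\<forall>\<^sub>F x in enlargement_filter B. h x = 0"
    unfolding eventually_enlargement_filter using \<open>0 < \<delta>\<close> half_gt_zero by blast
  moreover have "1 \<le> h x" if x: "x \<notin> G" for x
  proof -
    have "\<delta> \<le> dist x b" if "b \<in> B" for b
      using that x assms(3) by (force simp: enlarge_def dist_commute)
    then have "\<delta> \<le> infdist x B"
      unfolding infdist_notempty[OF assms(1)] by (intro cINF_greatest assms(1))
    then show ?thesis using \<open>0 < \<delta>\<close> by (simp add: h_def field_simps)
  qed
  ultimately show ?thesis by blast
qed

lemma metric_Urysohn:
  fixes A G :: "'a::metric_space set"
  assumes "closed A" "A \<noteq> {}" "open G" "A \<subseteq> G"
  shows "\<exists>h\<in>C_fun. (\<forall>x\<in>A. h x = 0) \<and> (\<forall>x. x \<notin> G \<longrightarrow> h x = 1)"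
proof (cases "G = UNIV")
  case True
  then show ?thesis by (intro bexI[of _ "\<lambda>_. 0"]) (auto simp: C_fun_def)
next
  case False
  define h where "h x = infdist x A / (infdist x A + infdist x (- G))" for x
  have zero: "infdist x A = 0 \<longleftrightarrow> x \<in> A" "infdist x (- G) = 0 \<longleftrightarrow> x \<notin> G" for x
    using in_closed_iff_infdist_zero[of A x] in_closed_iff_infdist_zero[of "- G" x] assms False
    by (auto simp: closed_Compl)
  then have "infdist x A + infdist x (- G) \<noteq> 0" for x
    using assms(4) infdist_nonneg[of x A] infdist_nonneg[of x "- G"]
    by (auto simp: add_nonneg_eq_0_iff)
  then have "h \<in> C_fun"
    unfolding C_fun_def h_def by (auto intro!: continuous_intros)
  moreover have "\<forall>x\<in>A. h x = 0" using zero by (simp add: h_def)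
  moreover have "\<forall>x. x \<notin> G \<longrightarrow> h x = 1" using zero assms(4) by (auto simp: h_def)
  ultimately show ?thesis by blast
qed

text \<open>
  A cover of the bornology contains a member around a closed superset \<open>B'\<close> of \<open>B\<close> in the bornology; Urysohn's
  lemma applies to \<open>B'\<close>, whereas the closure of \<open>B\<close> itself may leave a given open set around \<open>B\<close>.
\<close>

lemma closed_base_separation:
  assumes born: "bornology \<B>" and base: "has_closed_base \<B>" and cov: "open_cover \<B> \<G>"
    and B: "B \<in> \<B>"
  shows "\<exists>G\<in>\<G>. \<exists>h\<in>C_fun. (\<forall>\<^sub>F x in principal B. h x = 0) \<and> (\<forall>x. x \<notin> G \<longrightarrow> 1 \<le> h x)"
proof -
  obtain B' where B': "B' \<in> \<B>" "closed B'" "B \<subseteq> B'"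
    using base B unfolding has_closed_base_def bornology_base_def by blast
  obtain G where G: "G \<in> \<G>" "open G" "B' \<subseteq> G"
    using cov B'(1) unfolding open_cover_def by blast
  have "B' \<noteq> {}" using born B'(1) by (auto simp: bornology_def)
  then obtain h where h: "h \<in> C_fun" "\<forall>x\<in>B'. h x = 0" "\<forall>x. x \<notin> G \<longrightarrow> h x = 1"
    using metric_Urysohn[OF B'(2) _ G(2,3)] by blast
  have "\<forall>\<^sub>F x in principal B. h x = 0"
    unfolding eventually_principal using h(2) B'(3) by blast
  moreover have "\<forall>x. x \<notin> G \<longrightarrow> 1 \<le> h x" using h(3) by simp
  ultimately show ?thesis using G(1) h(1) by blast
qed

theorem theorem4p6:
  fixes \<B> :: "'a::metric_space set set"
  assumes "\<exists>x y :: 'a. x \<noteq> y"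
    and "bornology \<B>"
    and "has_closed_base \<B>"
  shows "tightness (strong_whitney_topology \<B>)
           =o strong_dominating_number \<B> *c strong_lindelof_number \<B> \<and>
         tightness (whitney_topology \<B>) =o dominating_number \<B> *c lindelof_number \<B>"
proof
  interpret strong: filter_whitney \<B> enlargement_filter "strong_whitney_uniformity \<B>"
  proof
    show "\<B> \<noteq> {}" by (rule bornology_nonempty[OF assms(2)])
    show "eventually P (strong_whitney_uniformity \<B>) \<longleftrightarrow>
      (\<exists>B\<in>\<B>. \<exists>e\<in>C_pos. \<forall>f\<in>C_fun. \<forall>g\<in>C_fun.
        (\<forall>\<^sub>F x in enlargement_filter B. \<bar>f x - g x\<bar> < e x) \<longrightarrow> P (f, g))" for P
      unfolding eventually_strong_whitney_uniformity[OF assms(2)] strong_whitney_entourage_def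
        eventually_enlargement_filter by blast
    fix \<G> B
    assume "\<forall>B\<in>\<B>. \<exists>G\<in>\<G>. \<forall>\<^sub>F x in enlargement_filter B. x \<in> G" and B: "B \<in> \<B>"
    then obtain G \<delta> where "G \<in> \<G>" "0 < \<delta>" "enlarge B \<delta> \<subseteq> G"
      unfolding eventually_enlargement_filter by blast
    moreover have "B \<noteq> {}" using assms(2) B by (auto simp: bornology_def)
    ultimately show "\<exists>G\<in>\<G>. \<exists>h\<in>C_fun. (\<forall>\<^sub>F x in enlargement_filter B. h x = 0) \<and>
        (\<forall>x. x \<notin> G \<longrightarrow> 1 \<le> h x)"
      by (intro bexI[of _ G] enlargement_separation[of B \<delta>])
  qed
  have "strong.dom_family = strongly_dominating \<B>" "strong.cover = strong_open_cover \<B>"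
    by (simp_all add: fun_eq_iff strong.dom_family_def strongly_dominating_def strong.cover_def
        strong_open_cover_def eventually_enlargement_filter subset_eq)
  then show "tightness (strong_whitney_topology \<B>)
      =o strong_dominating_number \<B> *c strong_lindelof_number \<B>"
    using strong.tightness_ordIso_product
    unfolding strong.dom_number_def strong.cover_number_def strong.cover_bound_def
      strong_dominating_number_def strong_lindelof_number_def strong_whitney_topology_def by simp
next
  interpret weak: filter_whitney \<B> principal "whitney_uniformity \<B>"
  proof
    show "\<B> \<noteq> {}" by (rule bornology_nonempty[OF assms(2)])
    show "eventually P (whitney_uniformity \<B>) \<longleftrightarrow>
      (\<exists>B\<in>\<B>. \<exists>e\<in>C_pos. \<forall>f\<in>C_fun. \<forall>g\<in>C_fun.
        (\<forall>\<^sub>F x in principal B. \<bar>f x - g x\<bar> < e x) \<longrightarrow> P (f, g))" for P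
      unfolding eventually_whitney_uniformity[OF assms(2)] whitney_entourage_def
        eventually_principal by blast
    fix \<G> B
    assume "\<forall>G\<in>\<G>. open G" "\<forall>B\<in>\<B>. \<exists>G\<in>\<G>. \<forall>\<^sub>F x in principal B. x \<in> G"
    then have "open_cover \<B> \<G>"
      unfolding open_cover_def eventually_principal subset_eq by blast
    moreover assume "B \<in> \<B>"
    ultimately show "\<exists>G\<in>\<G>. \<exists>h\<in>C_fun. (\<forall>\<^sub>F x in principal B. h x = 0) \<and>
        (\<forall>x. x \<notin> G \<longrightarrow> 1 \<le> h x)"
      by (rule closed_base_separation[OF assms(2,3)])
  qed
  have "weak.dom_family = dominating \<B>" "weak.cover = open_cover \<B>"
    by (simp_all add: fun_eq_iff weak.dom_family_def dominating_def weak.cover_def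
        open_cover_def eventually_principal subset_eq)
  then show "tightness (whitney_topology \<B>) =o dominating_number \<B> *c lindelof_number \<B>"
    using weak.tightness_ordIso_product
    unfolding weak.dom_number_def weak.cover_number_def weak.cover_bound_def dominating_number_def
      lindelof_number_def whitney_topology_def by simp
qed

end
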